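(* Let $(S,v)$ be a normed semigroup and $\phi:S\to S$ an endomorphism. If $\{S_i:i\in I\}$ is a directed family of $\phi$-invariant normed subsemigroups of $(S,v)$ with $S=\varinjlim_{i\in I}S_i$ and $\phi=\varinjlim_{i\in I}\phi\restriction_{S_i}$, then $h_{\mathfrak S}(\phi)=\sup_{i\in I}h_{\mathfrak S}(\phi\restriction_{S_i})$.
   Context: A normed semigroup $(S,v)$ is a semigroup $(S,\cdot)$ with a function $v:S\to\mathbb R_{\ge0}$. Endomorphisms are contractive semigroup endomorphisms: $v(\phi(x))\le v(x)$ for all $x$. A normed subsemigroup of $S$ is a subsemigroup with the restricted norm; it is $\phi$-invariant if $\phi$ maps it into itself. The family is directed by inclusion, and $S=\varinjlim S_i$ is the direct limit along the inclusions, i.e. $S=\bigcup_{i\in I}S_i$. For $x\in S$, $T_n(\phi,x)=x\cdot\phi(x)\cdots\phi^{n-1}(x)$, $h_{\mathfrak S}(\phi,x)=\limsup_{n\to\infty}\frac{v(T_n(\phi,x))}{n}$, and $h_{\mathfrak S}(\phi)=\sup_{x\in S}h_{\mathfrak S}(\phi,x)\in[0,\infty]$. *)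

theory Defs
  imports Complex_Main "HOL-Library.FuncSet" "HOL-Library.Extended_Nonnegative_Real"
begin

locale normed_semigroup =
  fixes S :: "'a set"
    and mult :: "'a \<Rightarrow> 'a \<Rightarrow> 'a"
    and v :: "'a \<Rightarrow> real"
  assumes mult_closed: "x \<in> S \<Longrightarrow> y \<in> S \<Longrightarrow> mult x y \<in> S"
    and mult_assoc: "x \<in> S \<Longrightarrow> y \<in> S \<Longrightarrow> z \<in> S \<Longrightarrow> mult (mult x y) z = mult x (mult y z)"
    and norm_nonneg: "x \<in> S \<Longrightarrow> 0 \<le> v x"

locale normed_semigroup_endo = normed_semigroup S mult v
  for S :: "'a set" and mult :: "'a \<Rightarrow> 'a \<Rightarrow> 'a" and v :: "'a \<Rightarrow> real" +
  fixes phi :: "'a \<Rightarrow> 'a"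
  assumes endo_closed: "phi \<in> S \<rightarrow> S"
    and endo_mult: "x \<in> S \<Longrightarrow> y \<in> S \<Longrightarrow> phi (mult x y) = mult (phi x) (phi y)"
    and endo_contractive: "x \<in> S \<Longrightarrow> v (phi x) \<le> v x"

definition subsemigroup :: "'a set \<Rightarrow> ('a \<Rightarrow> 'a \<Rightarrow> 'a) \<Rightarrow> 'a set \<Rightarrow> bool" where
  "subsemigroup A mult S \<longleftrightarrow> A \<subseteq> S \<and> (\<forall>x\<in>A. \<forall>y\<in>A. mult x y \<in> A)"

definition invariant_under :: "('a \<Rightarrow> 'a) \<Rightarrow> 'a set \<Rightarrow> bool" where
  "invariant_under phi A \<longleftrightarrow> phi \<in> A \<rightarrow> A"

definition directed_family :: "'i set \<Rightarrow> ('i \<Rightarrow> 'a set) \<Rightarrow> bool" where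
  "directed_family I A \<longleftrightarrow>
     I \<noteq> {} \<and> (\<forall>i\<in>I. \<forall>j\<in>I. \<exists>k\<in>I. A i \<subseteq> A k \<and> A j \<subseteq> A k)"

text \<open>Direct limits of subsets, and of maps on them, are taken along the inclusions.\<close>

definition is_direct_limit :: "'i set \<Rightarrow> ('i \<Rightarrow> 'a set) \<Rightarrow> 'a set \<Rightarrow> bool" where
  "is_direct_limit I A S \<longleftrightarrow> S = (\<Union>i\<in>I. A i)"

definition is_direct_limit_map ::
  "'i set \<Rightarrow> ('i \<Rightarrow> 'a set) \<Rightarrow> ('i \<Rightarrow> 'a \<Rightarrow> 'a) \<Rightarrow> 'a set \<Rightarrow> ('a \<Rightarrow> 'a) \<Rightarrow> bool" where
  "is_direct_limit_map I A psi S phi \<longleftrightarrow>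
     is_direct_limit I A S \<and> (\<forall>i\<in>I. \<forall>x\<in>A i. phi x = psi i x)"

text \<open>The product of \<open>x, phi x, \<dots>, phi\<^sup>n\<^sup>-\<^sup>1 x\<close> for \<open>n \<ge> 1\<close>. A semigroup has no empty product;
  the value \<open>x\<close> at \<open>n = 0\<close> is arbitrary and does not affect the limit superior below.\<close>

definition trajectory :: "('a \<Rightarrow> 'a \<Rightarrow> 'a) \<Rightarrow> ('a \<Rightarrow> 'a) \<Rightarrow> nat \<Rightarrow> 'a \<Rightarrow> 'a" where
  "trajectory mult phi n x = foldl mult x (map (\<lambda>k. (phi ^^ k) x) [1..<n])"

text \<open>Entropies take values in \<open>[0,\<infinity>]\<close>; in particular a supremum over the empty set is \<open>0\<close>.\<close>

definition local_entropy ::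
  "('a \<Rightarrow> 'a \<Rightarrow> 'a) \<Rightarrow> ('a \<Rightarrow> real) \<Rightarrow> ('a \<Rightarrow> 'a) \<Rightarrow> 'a \<Rightarrow> ennreal" where
  "local_entropy mult v phi x =
     limsup (\<lambda>n. ennreal (v (trajectory mult phi n x) / real n))"

definition semigroup_entropy ::
  "'a set \<Rightarrow> ('a \<Rightarrow> 'a \<Rightarrow> 'a) \<Rightarrow> ('a \<Rightarrow> real) \<Rightarrow> ('a \<Rightarrow> 'a) \<Rightarrow> ennreal" where
  "semigroup_entropy S mult v phi = (SUP x\<in>S. local_entropy mult v phi x)"

end

theory Submission
  imports Defs
begin

text \<open>The local entropy at a point \<open>x\<close> of \<open>A i\<close> is intrinsic to
  \<open>A i\<close>: the trajectory of \<open>x\<close> never leaves this invariant subsemigroup,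
  where the restricted map and norm agree with the original ones
  (\<open>local_entropy_restrict\<close>, hence \<open>semigroup_entropy_restrict\<close>). As
  \<open>S\<close> is the union of the \<open>A i\<close>, the supremum over \<open>S\<close> splits
  into a supremum over \<open>i\<close> of suprema over \<open>A i\<close>.\<close>

lemma funpow_mem:
  assumes "phi \<in> A \<rightarrow> A" "x \<in> A"
  shows "(phi ^^ k) x \<in> A"
  using assms by (induction k) auto

text \<open>\<open>restrict phi A\<close> is \<open>undefined\<close> off \<open>A\<close>;
  invariance ensures that iteration from \<open>x\<close> never evaluates it there.\<close>

lemma funpow_restrict:
  assumes "phi \<in> A \<rightarrow> A" "x \<in> A"
  shows "(restrict phi A ^^ k) x = (phi ^^ k) x"
  using assms by (induction k) (auto simp: funpow_mem)

lemma foldl_mem: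
  assumes "\<And>x y. x \<in> A \<Longrightarrow> y \<in> A \<Longrightarrow> f x y \<in> A" "a \<in> A" "set xs \<subseteq> A"
  shows "foldl f a xs \<in> A"
  using assms(2,3) by (induction xs arbitrary: a) (auto intro: assms(1))

lemma trajectory_mem:
  assumes "subsemigroup A mult S" "phi \<in> A \<rightarrow> A" "x \<in> A"
  shows "trajectory mult phi n x \<in> A"
  unfolding trajectory_def
  using assms by (intro foldl_mem) (auto simp: subsemigroup_def funpow_mem)

lemma trajectory_restrict:
  assumes "phi \<in> A \<rightarrow> A" "x \<in> A"
  shows "trajectory mult (restrict phi A) n x = trajectory mult phi n x"
  using assms by (simp add: trajectory_def funpow_restrict)

text \<open>The two sequences agree term by term, even at \<open>n = 0\<close>, where the trajectory
  is \<open>x\<close>; so no limit argument arises.\<close>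

lemma local_entropy_restrict:
  assumes "subsemigroup A mult S" "phi \<in> A \<rightarrow> A" "x \<in> A"
  shows "local_entropy mult (restrict v A) (restrict phi A) x = local_entropy mult v phi x"
  using assms by (simp add: local_entropy_def trajectory_restrict trajectory_mem[OF assms])

lemma semigroup_entropy_restrict:
  assumes "subsemigroup A mult S" "phi \<in> A \<rightarrow> A"
  shows "semigroup_entropy A mult (restrict v A) (restrict phi A) = semigroup_entropy A mult v phi"
  unfolding semigroup_entropy_def
  by (intro SUP_cong) (simp_all add: local_entropy_restrict[OF assms])

theorem proposition3p8:
  fixes S :: "'a set" and mult :: "'a \<Rightarrow> 'a \<Rightarrow> 'a" and v :: "'a \<Rightarrow> real"
    and phi :: "'a \<Rightarrow> 'a" and I :: "'i set" and A :: "'i \<Rightarrow> 'a set"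
  assumes "normed_semigroup S mult v"
    and "normed_semigroup_endo S mult v phi"
    and "directed_family I A"
    and "\<And>i. i \<in> I \<Longrightarrow> subsemigroup (A i) mult S"
    and "\<And>i. i \<in> I \<Longrightarrow> invariant_under phi (A i)"
    and "is_direct_limit I A S"
    and "is_direct_limit_map I A (\<lambda>i. restrict phi (A i)) S phi"
  shows "semigroup_entropy S mult v phi =
    (SUP i\<in>I. semigroup_entropy (A i) mult (restrict v (A i)) (restrict phi (A i)))"
proof -
  have "semigroup_entropy S mult v phi = (SUP i\<in>I. semigroup_entropy (A i) mult v phi)"
    \<comment> \<open>A supremum over a union is the supremum of the suprema over its
      members.\<close>
    using assms(6) by (simp add: is_direct_limit_def semigroup_entropy_def SUP_UNION)
  also have "\<dots> = (SUP i\<in>I. semigroup_entropy (A i) mult (restrict v (A i)) (restrict phi (A i)))"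
    using semigroup_entropy_restrict[OF assms(4)] assms(5)
    by (intro SUP_cong) (auto simp: invariant_under_def)
  finally show ?thesis .
qed

end
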